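(* Let $X$ be a reduced subscheme of $\mathbb{P}^n$ contained in a hypersurface of degree $d+1\ge 1$. Then for any $m\ge 1$ and $t\ge d+m$ we have $$\operatorname{adim}(X,t,m)=\operatorname{vdim}(X,t,m).$$ In particular, if $X$ is degenerate (meaning that $X$ is contained in a hyperplane, i.e. $d=0$), then $X$ admits no unexpected hypersurfaces for multiplicity $m$ in degrees $t\ge m$, and hence no unexpected hypersurfaces of any kind (any degree and any multiplicity).
   Context: $K$ is an infinite field and $R=K[x_0,\dots,x_n]$. For a closed subscheme $X\subseteq\mathbb{P}^n$, $I_X\subseteq R$ is its saturated homogeneous ideal; $[\,\cdot\,]_t$ is the degree $t$ component. Let $P\in\mathbb{P}^n$ be a general point (i.e. in a suitable nonempty Zariski open subset) with ideal $I_P$. Set $\operatorname{adim}(X,t,m)=\dim[I_X\cap I_P^m]_t$, $\operatorname{vdim}(X,t,m)=\dim[I_X]_t-\binom{m+n-1}{n}$, $\operatorname{edim}(X,t,m)=\max\{0,\operatorname{vdim}(X,t,m)\}$. $X$ admits an unexpected hypersurface of degree $t$ for multiplicity $m$ if $\operatorname{adim}(X,t,m)>\operatorname{edim}(X,t,m)$ (which forces $t\ge m$). *)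

theory Defs
  imports Complex_Main "HOL-Library.Poly_Mapping" "HOL-Library.Cardinality"
begin

text \<open>
  The ring \<open>K[x\<^sub>0,\<dots>,x\<^sub>n]\<close> is \<open>('v, 'a) mpoly\<close>, where the field \<open>'a\<close> is \<open>K\<close> and the finite type
  \<open>'v\<close>, with \<open>CARD('v) = n + 1\<close>, is the index set of the variables. A power product is a finitely
  supported exponent vector, and \<open>*\<close> is the convolution product of the library.
\<close>

type_synonym ('v, 'a) mpoly = "('v \<Rightarrow>\<^sub>0 nat) \<Rightarrow>\<^sub>0 'a"

text \<open>
  A commutative ring is a module over itself: \<open>ideal.subspace I\<close> says that \<open>I\<close> is an ideal, and
  \<open>ideal.span S\<close> is the ideal generated by \<open>S\<close>.
\<close>

global_interpretation ideal: module "(*) :: 'r::comm_ring_1 \<Rightarrow> 'r \<Rightarrow> 'r"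
  by standard (simp_all add: algebra_simps)

text \<open>
  The polynomial ring as a \<open>K\<close>-vector space: \<open>mpoly.dim\<close> is the dimension over \<open>K\<close>.
\<close>

global_interpretation mpoly: vector_space
  "\<lambda>(c::'a::field) (p::('v, 'a) mpoly). Poly_Mapping.single 0 c * p"
  by standard
    (simp_all add: distrib_left distrib_right single_add mult_single single_one mult.assoc[symmetric])

definition var :: "'v \<Rightarrow> ('v, 'a::field) mpoly" where
  "var i = Poly_Mapping.single (Poly_Mapping.single i 1) 1"

definition eval :: "('v::finite, 'a::field) mpoly \<Rightarrow> ('v \<Rightarrow> 'a) \<Rightarrow> 'a" where
  "eval p P = (\<Sum>e\<in>Poly_Mapping.keys p.
     Poly_Mapping.lookup p e * (\<Prod>i\<in>UNIV. P i ^ Poly_Mapping.lookup e i))"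

definition forms :: "nat \<Rightarrow> ('v::finite, 'a::field) mpoly set" where
  "forms t = {p. \<forall>e\<in>Poly_Mapping.keys p. (\<Sum>i\<in>UNIV. Poly_Mapping.lookup e i) = t}"

primrec ideal_pow :: "'r::comm_ring_1 set \<Rightarrow> nat \<Rightarrow> 'r set" where
  "ideal_pow I 0 = UNIV"
| "ideal_pow I (Suc m) = ideal.span {a * b | a b. a \<in> I \<and> b \<in> ideal_pow I m}"

definition homogeneous_ideal :: "('v::finite, 'a::field) mpoly set \<Rightarrow> bool" where
  "homogeneous_ideal I \<longleftrightarrow> ideal.subspace I \<and> I = ideal.span {p \<in> I. \<exists>t. p \<in> forms t}"

definition irrelevant_ideal :: "('v::finite, 'a::field) mpoly set" where
  "irrelevant_ideal = ideal.span (range var)"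

definition saturated :: "('v::finite, 'a::field) mpoly set \<Rightarrow> bool" where
  "saturated I \<longleftrightarrow>
     (\<forall>p. (\<exists>k. \<forall>q\<in>ideal_pow irrelevant_ideal k. q * p \<in> I) \<longrightarrow> p \<in> I)"

text \<open>
  Closed subschemes \<open>X\<close> of \<open>P\<^sup>n\<close> correspond bijectively to saturated homogeneous ideals, via
  \<open>X \<mapsto> I\<^sub>X\<close>; the empty subscheme has \<open>I\<^sub>X = UNIV\<close>. A subscheme is represented by \<open>I\<^sub>X\<close>, and it is
  reduced iff \<open>I\<^sub>X\<close> is a radical ideal.
\<close>

definition closed_subscheme :: "('v::finite, 'a::field) mpoly set \<Rightarrow> bool" where
  "closed_subscheme X \<longleftrightarrow> homogeneous_ideal X \<and> saturated X"

definition reduced_subscheme :: "('v::finite, 'a::field) mpoly set \<Rightarrow> bool" where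
  "reduced_subscheme X \<longleftrightarrow> closed_subscheme X \<and> (\<forall>p k. p ^ k \<in> X \<longrightarrow> p \<in> X)"

definition in_hypersurface_of_degree :: "('v::finite, 'a::field) mpoly set \<Rightarrow> nat \<Rightarrow> bool" where
  "in_hypersurface_of_degree X e \<longleftrightarrow> (\<exists>F\<in>forms e. F \<noteq> 0 \<and> F \<in> X)"

definition degenerate :: "('v::finite, 'a::field) mpoly set \<Rightarrow> bool" where
  "degenerate X \<longleftrightarrow> in_hypersurface_of_degree X 1"

text \<open>
  A (\<open>K\<close>-rational) point of \<open>P\<^sup>n\<close> is given by any nonzero vector of homogeneous coordinates. The
  sets below are unions of classes of proportional vectors, and \<open>point_ideal P\<close> depends only on
  the class of \<open>P\<close>.
\<close>

definition zariski_open :: "('v::finite \<Rightarrow> 'a::field) set \<Rightarrow> bool" where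
  "zariski_open U \<longleftrightarrow>
     (\<exists>S. S \<subseteq> (\<Union>t. forms t) \<and> U = {P. P \<noteq> (\<lambda>_. 0) \<and> (\<exists>F\<in>S. eval F P \<noteq> 0)})"

definition for_general_point :: "(('v::finite \<Rightarrow> 'a::field) \<Rightarrow> bool) \<Rightarrow> bool" where
  "for_general_point Q \<longleftrightarrow> (\<exists>U. zariski_open U \<and> U \<noteq> {} \<and> (\<forall>P\<in>U. Q P))"

definition point_ideal :: "('v::finite \<Rightarrow> 'a::field) \<Rightarrow> ('v, 'a) mpoly set" where
  "point_ideal P = ideal.span {F. (\<exists>t. F \<in> forms t) \<and> eval F P = 0}"

text \<open>
  The dimension of \<open>[I\<^sub>X \<inter> I\<^sub>P\<^sup>m]\<^sub>t\<close> is upper semicontinuous in \<open>P\<close>, so it is constant on a nonempty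
  open set. Over an infinite field any two nonempty open sets meet, so this constant is unique.
\<close>

definition adim :: "('v::finite, 'a::field) mpoly set \<Rightarrow> nat \<Rightarrow> nat \<Rightarrow> nat" where
  "adim X t m =
     (THE a. for_general_point (\<lambda>P. mpoly.dim (X \<inter> ideal_pow (point_ideal P) m \<inter> forms t) = a))"

definition vdim :: "('v::finite, 'a::field) mpoly set \<Rightarrow> nat \<Rightarrow> nat \<Rightarrow> int" where
  "vdim X t m =
     (let n = CARD('v) - 1 in int (mpoly.dim (X \<inter> forms t)) - int ((m + n - 1) choose n))"

definition edim :: "('v::finite, 'a::field) mpoly set \<Rightarrow> nat \<Rightarrow> nat \<Rightarrow> int" where
  "edim X t m = max 0 (vdim X t m)"

definition unexpected_hypersurface :: "('v::finite, 'a::field) mpoly set \<Rightarrow> nat \<Rightarrow> nat \<Rightarrow> bool" where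
  "unexpected_hypersurface X t m \<longleftrightarrow> int (adim X t m) > edim X t m"

end

theory Submission
  imports Defs "HOL-Computational_Algebra.Polynomial"
begin

text \<open>
  Let \<open>F\<close> be a nonzero form of degree \<open>d + 1\<close> in \<open>I\<^sub>X\<close>, let \<open>P\<close> be a point with \<open>F(P) \<noteq> 0\<close>, and let
  \<open>t \<ge> d + m\<close> with \<open>m \<ge> 1\<close>. In degrees \<open>s \<ge> m - 1\<close> the graded piece of \<open>R / I\<^sub>P\<^sup>m\<close> has dimension
  \<open>(m + n - 1) choose n\<close>, and multiplication by \<open>F\<close> is injective on \<open>R / I\<^sub>P\<^sup>m\<close>. So already the multiples
  of \<open>F\<close> in degree \<open>t\<close>, whose cofactors have degree \<open>t - d - 1 \<ge> m - 1\<close>, fill the degree \<open>t\<close> piece of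
  \<open>R / I\<^sub>P\<^sup>m\<close>. Hence the conditions imposed by \<open>m P\<close> on \<open>[I\<^sub>X]\<^sub>t\<close> are independent.

  For an explicit argument, choose a variable \<open>a\<close> that does not vanish at \<open>P\<close> and apply the shear
  that moves \<open>P\<close> to the unit vector of \<open>a\<close>. A polynomial lies in \<open>I\<^sub>P\<^sup>m\<close> iff all monomials of its
  image have degree at least \<open>m\<close> in the variables other than \<open>a\<close> (\<open>ideal_pow_point_ideal_iff\<close>). So
  \<open>[I\<^sub>X \<inter> I\<^sub>P\<^sup>m]\<^sub>t\<close> is cut out of \<open>[I\<^sub>X]\<^sub>t\<close> by the coefficients of the remaining monomials of degree \<open>t\<close>,
  of which there are \<open>(m + n - 1) choose n\<close> (\<open>card_mdeg_off_less\<close>). These functionals are triangular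
  with respect to suitable multiples of \<open>F\<close>, so the dimension drops by exactly their number
  (\<open>dim_kernel_triangular\<close>, \<open>dim_fat_point\<close>).

  Over an infinite field \<open>F(P) \<noteq> 0\<close> is a nonempty open condition
  (\<open>for_general_point_off_hypersurface\<close>), and nonempty open sets meet (\<open>for_general_point_meet\<close>), which
  makes the generic dimension unique. If \<open>d = 0\<close>, the formula covers the degrees \<open>t \<ge> m\<close>, and for
  \<open>t < m\<close> the space \<open>[I\<^sub>P\<^sup>m]\<^sub>t\<close> is zero.
\<close>

section \<open>Exponent vectors and forms\<close>

text \<open>The total degree of an exponent vector, and its degree in the variables other than \<open>a\<close>.\<close>

definition mdeg :: "('v::finite \<Rightarrow>\<^sub>0 nat) \<Rightarrow> nat" where
  "mdeg e = (\<Sum>i\<in>UNIV. Poly_Mapping.lookup e i)"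

definition mdeg_off :: "'v \<Rightarrow> ('v::finite \<Rightarrow>\<^sub>0 nat) \<Rightarrow> nat" where
  "mdeg_off a e = (\<Sum>i\<in>UNIV - {a}. Poly_Mapping.lookup e i)"

lemma mdeg_split: "mdeg e = Poly_Mapping.lookup e a + mdeg_off a e"
  unfolding mdeg_def mdeg_off_def by (simp add: sum.remove)

lemma mdeg_add: "mdeg (e + f) = mdeg e + mdeg f"
  by (simp add: mdeg_def lookup_add sum.distrib)

lemma mdeg_off_add: "mdeg_off a (e + f) = mdeg_off a e + mdeg_off a f"
  by (simp add: mdeg_off_def lookup_add sum.distrib)

lemma mdeg_off_single_same [simp]: "mdeg_off a (Poly_Mapping.single a k) = 0"
  by (simp add: mdeg_off_def lookup_single when_def)

lemma mdeg_off_single_other: "i \<noteq> a \<Longrightarrow> mdeg_off a (Poly_Mapping.single i k) = k"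
  by (simp add: mdeg_off_def lookup_single when_def if_distrib)

lemma mdeg_single [simp]: "mdeg (Poly_Mapping.single i k) = k"
  by (simp add: mdeg_def lookup_single when_def)

lemma mdeg_off_eq_0_iff: "mdeg_off a e = 0 \<longleftrightarrow> e = Poly_Mapping.single a (mdeg e)"
proof
  assume h: "mdeg_off a e = 0"
  hence "Poly_Mapping.lookup e i = 0" if "i \<noteq> a" for i
    using that by (auto simp: mdeg_off_def)
  thus "e = Poly_Mapping.single a (mdeg e)"
    using h mdeg_split[of e a] by (intro poly_mapping_eqI) (auto simp: lookup_single when_def)
qed (metis mdeg_off_single_same)

lemma forms_iff: "p \<in> forms t \<longleftrightarrow> (\<forall>e\<in>Poly_Mapping.keys p. mdeg e = t)"
  by (simp add: forms_def mdeg_def)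

lemma forms_0 [simp]: "0 \<in> forms t"
  by (simp add: forms_iff)

lemma forms_single: "mdeg e = t \<Longrightarrow> Poly_Mapping.single e c \<in> forms t"
  by (simp add: forms_iff)

lemma forms_const: "Poly_Mapping.single 0 c \<in> forms 0"
  by (rule forms_single) (simp add: mdeg_def)

lemma forms_var: "var i \<in> forms (Suc 0)"
  unfolding var_def by (rule forms_single) simp

lemma forms_add: "p \<in> forms t \<Longrightarrow> q \<in> forms t \<Longrightarrow> p + q \<in> forms t"
  unfolding forms_iff using Poly_Mapping.keys_add[of p q] by blast

lemma forms_sum: "(\<And>i. i \<in> S \<Longrightarrow> f i \<in> forms t) \<Longrightarrow> sum f S \<in> forms t"
  by (induction S rule: infinite_finite_induct) (auto intro: forms_add)

lemma forms_mult: "p \<in> forms s \<Longrightarrow> q \<in> forms t \<Longrightarrow> p * q \<in> forms (s + t)"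
  unfolding forms_iff using keys_mult[of p q] by (fastforce simp: mdeg_add)

lemma forms_scale: "p \<in> forms t \<Longrightarrow> Poly_Mapping.single 0 c * p \<in> forms t"
  using forms_mult[OF forms_const] by simp

lemma forms_power: "p \<in> forms s \<Longrightarrow> p ^ k \<in> forms (s * k)"
proof (induction k)
  case 0
  show ?case using forms_const[of 1] by simp
next
  case (Suc k)
  thus ?case using forms_mult[of p s "p ^ k" "s * k"] by simp
qed

lemma forms_prod: "(\<And>i. i \<in> S \<Longrightarrow> f i \<in> forms (d i)) \<Longrightarrow> prod f S \<in> forms (sum d S)"
proof (induction S rule: infinite_finite_induct)
  case (insert i S)
  thus ?case by (simp add: forms_mult)
qed (use forms_const[of 1] in simp_all)

lemma mpoly_sum_monomials: "(\<Sum>e\<in>Poly_Mapping.keys p. Poly_Mapping.single e (Poly_Mapping.lookup p e)) = p"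
  by (rule poly_mapping_eqI) (auto simp: lookup_sum lookup_single when_def in_keys_iff)

lemma mpoly_induct [case_names monomial add]:
  fixes p :: "'k \<Rightarrow>\<^sub>0 'b::comm_monoid_add"
  assumes "\<And>e c. Q (Poly_Mapping.single e c)"
    and "\<And>p q. Q p \<Longrightarrow> Q q \<Longrightarrow> Q (p + q)"
  shows "Q p"
proof -
  have "Q 0" using assms(1)[of _ 0] by simp
  hence "Q (\<Sum>e\<in>S. Poly_Mapping.single e (Poly_Mapping.lookup p e))" for S
    by (induction S rule: infinite_finite_induct) (auto intro: assms)
  from this[of "Poly_Mapping.keys p"] show ?thesis by (simp add: mpoly_sum_monomials)
qed

lemma lookup_monomial_mult:
  "Poly_Mapping.lookup (Poly_Mapping.single e c * q) (e + f) = c * Poly_Mapping.lookup q f"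
  for q :: "('v, 'a::field) mpoly"
proof (induction q rule: mpoly_induct)
  case (monomial e' c')
  show ?case by (simp add: mult_single lookup_single when_def)
qed (simp add: distrib_left lookup_add)

lemma lookup_const_mult:
  "Poly_Mapping.lookup (Poly_Mapping.single 0 c * q) f = c * Poly_Mapping.lookup q f"
  for q :: "('v, 'a::field) mpoly"
  using lookup_monomial_mult[of 0 c q f] by simp

section \<open>Counting monomials\<close>

lemma bij_betw_mdeg_lists:
  assumes "distinct xs" and "set xs = (UNIV :: 'v::finite set)"
  shows "bij_betw (\<lambda>e. map (Poly_Mapping.lookup e) xs) {e :: 'v \<Rightarrow>\<^sub>0 nat. mdeg e = k}
           {l. length l = length xs \<and> sum_list l = k}"
proof (rule bij_betw_imageI)
  show "inj_on (\<lambda>e. map (Poly_Mapping.lookup e) xs) {e. mdeg e = k}"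
    using assms(2) by (auto intro!: inj_onI poly_mapping_eqI)
  have "\<exists>e. mdeg e = k \<and> map (Poly_Mapping.lookup e) xs = l"
    if l: "length l = length xs" "sum_list l = k" for l
  proof -
    define e where "e = Abs_poly_mapping (\<lambda>i. the (map_of (zip xs l) i))"
    have "map (Poly_Mapping.lookup e) xs = l"
      by (rule nth_equalityI) (use l assms(1) in \<open>auto simp: e_def map_of_zip_nth\<close>)
    moreover have "mdeg e = sum_list (map (Poly_Mapping.lookup e) xs)"
      using assms by (simp add: mdeg_def sum_list_distinct_conv_sum_set)
    ultimately show ?thesis using l by auto
  qed
  hence "{l. length l = length xs \<and> sum_list l = k} \<subseteq>
      (\<lambda>e. map (Poly_Mapping.lookup e) xs) ` {e. mdeg e = k}"
    by blast
  moreover have "(\<lambda>e. map (Poly_Mapping.lookup e) xs) ` {e. mdeg e = k} \<subseteq>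
      {l. length l = length xs \<and> sum_list l = k}"
    using assms by (auto simp: mdeg_def sum_list_distinct_conv_sum_set)
  ultimately show "(\<lambda>e. map (Poly_Mapping.lookup e) xs) ` {e. mdeg e = k} =
      {l. length l = length xs \<and> sum_list l = k}"
    by (rule subset_antisym[rotated])
qed

lemma finite_mdeg: "finite {e :: 'v::finite \<Rightarrow>\<^sub>0 nat. mdeg e = k}"
proof -
  obtain xs where xs: "distinct xs" "set xs = (UNIV :: 'v set)"
    using finite_distinct_list[of "UNIV :: 'v set"] by auto
  have "finite {l. length l = length xs \<and> sum_list l = k}"
    by (rule finite_subset[OF _ finite_lists_length_eq[of "{..k}" "length xs"]])
       (auto dest: member_le_sum_list)
  thus ?thesis using bij_betw_finite[OF bij_betw_mdeg_lists[OF xs, of k]] by simp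
qed

lemma card_mdeg:
  "card {e :: 'v::finite \<Rightarrow>\<^sub>0 nat. mdeg e = k} = (k + (CARD('v) - 1)) choose (CARD('v) - 1)"
proof -
  obtain xs where xs: "distinct xs" "set xs = (UNIV :: 'v set)"
    using finite_distinct_list[of "UNIV :: 'v set"] by auto
  have len: "length xs = CARD('v)" using distinct_card[OF xs(1)] xs(2) by simp
  have "card {e :: 'v \<Rightarrow>\<^sub>0 nat. mdeg e = k} = (k + CARD('v) - 1) choose k"
    using bij_betw_same_card[OF bij_betw_mdeg_lists[OF xs, of k]]
    by (simp add: card_length_sum_list len)
  also have "k + CARD('v) - 1 = k + (CARD('v) - 1)"
    using zero_less_card_finite[where 'a = 'v] by linarith
  also have "\<dots> choose k = \<dots> choose (CARD('v) - 1)"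
    by (metis add_diff_cancel_left' binomial_symmetric le_add1)
  finally show ?thesis .
qed

text \<open>
  The exponent of \<open>a\<close> is determined by the total degree and the other exponents. Since \<open>m - 1 \<le> t\<close>,
  changing it is a bijection from the set counted here to all exponent vectors of degree \<open>m - 1\<close>.
\<close>

lemma card_mdeg_off_less:
  assumes "1 \<le> m" and "m \<le> t + 1"
  shows "card {e :: 'v::finite \<Rightarrow>\<^sub>0 nat. mdeg e = t \<and> mdeg_off a e < m} =
    (m + (CARD('v) - 1) - 1) choose (CARD('v) - 1)"
proof -
  define u where "u s e = Poly_Mapping.update a (s - mdeg_off a e) e" for s and e :: "'v \<Rightarrow>\<^sub>0 nat"
  have off: "mdeg_off a (u s e) = mdeg_off a e" for s e
    unfolding u_def mdeg_off_def by (rule sum.cong) (auto simp: lookup_update)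
  have lk: "Poly_Mapping.lookup (u s e) i = (if i = a then s - mdeg_off a e else Poly_Mapping.lookup e i)" for s e i
    by (simp add: u_def lookup_update)
  have deg: "mdeg (u s e) = (s - mdeg_off a e) + mdeg_off a e" for s e
    using mdeg_split[of "u s e" a] by (simp add: off lk)
  have uu: "u s (u s' e) = e" if "mdeg e = s" for s s' e
    by (rule poly_mapping_eqI) (use that mdeg_split[of e a] in \<open>auto simp: lk off\<close>)
  have "bij_betw (u (m - 1)) {e. mdeg e = t \<and> mdeg_off a e < m} {e. mdeg e = m - 1}"
  proof (rule bij_betw_byWitness[where f' = "u t"])
    show "u t ` {e. mdeg e = m - 1} \<subseteq> {e. mdeg e = t \<and> mdeg_off a e < m}"
    proof clarify
      fix e :: "'v \<Rightarrow>\<^sub>0 nat" assume "mdeg e = m - 1"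
      hence "mdeg_off a e \<le> m - 1" using mdeg_split[of e a] by simp
      thus "mdeg (u t e) = t \<and> mdeg_off a (u t e) < m" using assms by (simp add: deg off)
    qed
  qed (use assms in \<open>auto simp: uu deg\<close>)
  from bij_betw_same_card[OF this] show ?thesis using assms by (simp add: card_mdeg)
qed

section \<open>Substitution homomorphisms\<close>

text \<open>
  The substitution of \<open>g i\<close> for the variable \<open>i\<close>, with coefficients transported along \<open>h\<close>. Both
  the evaluation at a point and linear changes of coordinates are of this kind.
\<close>

definition subst_hom ::
  "('a::field \<Rightarrow> 'r::comm_ring_1) \<Rightarrow> ('v::finite \<Rightarrow> 'r) \<Rightarrow> ('v, 'a) mpoly \<Rightarrow> 'r" where
  "subst_hom h g p = (\<Sum>e\<in>Poly_Mapping.keys p.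
     h (Poly_Mapping.lookup p e) * (\<Prod>i\<in>UNIV. g i ^ Poly_Mapping.lookup e i))"

locale coeff_hom =
  fixes h :: "'a::field \<Rightarrow> 'r::comm_ring_1"
  assumes hom_add: "h (x + y) = h x + h y"
    and hom_mult: "h (x * y) = h x * h y"
    and hom_1: "h 1 = 1"
begin

lemma hom_0: "h 0 = 0"
  using hom_add[of 0 0] by simp

lemma subst_hom_superset:
  assumes "finite S" and "Poly_Mapping.keys p \<subseteq> S"
  shows "subst_hom h g p =
    (\<Sum>e\<in>S. h (Poly_Mapping.lookup p e) * (\<Prod>i\<in>UNIV. g i ^ Poly_Mapping.lookup e i))"
  unfolding subst_hom_def
  by (rule sum.mono_neutral_left) (use assms in \<open>auto simp: in_keys_iff hom_0\<close>)

lemma subst_hom_add: "subst_hom h g (p + q) = subst_hom h g p + subst_hom h g q"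
proof -
  let ?S = "Poly_Mapping.keys p \<union> Poly_Mapping.keys q"
  have "subst_hom h g r =
      (\<Sum>e\<in>?S. h (Poly_Mapping.lookup r e) * (\<Prod>i\<in>UNIV. g i ^ Poly_Mapping.lookup e i))"
    if "Poly_Mapping.keys r \<subseteq> ?S" for r
    using that by (intro subst_hom_superset) auto
  thus ?thesis
    by (simp add: Poly_Mapping.keys_add lookup_add hom_add distrib_right sum.distrib)
qed

lemma subst_hom_single:
  "subst_hom h g (Poly_Mapping.single e c) = h c * (\<Prod>i\<in>UNIV. g i ^ Poly_Mapping.lookup e i)"
  by (subst subst_hom_superset[of "{e}"]) auto

lemma subst_hom_mult: "subst_hom h g (p * q) = subst_hom h g p * subst_hom h g q"
proof (induction p rule: mpoly_induct)
  case (monomial e c)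
  show ?case
  proof (induction q rule: mpoly_induct)
    case (monomial f d)
    show ?case
      by (simp add: mult_single subst_hom_single hom_mult lookup_add power_add prod.distrib)
  qed (simp add: distrib_left subst_hom_add)
qed (simp add: distrib_right subst_hom_add)

lemma subst_hom_const: "subst_hom h g (Poly_Mapping.single 0 c) = h c"
  by (simp add: subst_hom_single)

lemma subst_hom_1: "subst_hom h g 1 = 1"
  using subst_hom_const[of g 1] by (simp add: hom_1)

lemma subst_hom_0: "subst_hom h g 0 = 0"
  by (simp add: subst_hom_def)

lemma subst_hom_power: "subst_hom h g (p ^ k) = subst_hom h g p ^ k"
  by (induction k) (simp_all add: subst_hom_1 subst_hom_mult)

lemma subst_hom_prod: "subst_hom h g (prod f S) = (\<Prod>i\<in>S. subst_hom h g (f i))"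
  by (induction S rule: infinite_finite_induct) (simp_all add: subst_hom_1 subst_hom_mult)

lemma subst_hom_var: "subst_hom h g (var i) = g i"
proof -
  have "(\<Prod>j\<in>UNIV. g j ^ Poly_Mapping.lookup (Poly_Mapping.single i 1) j) = (\<Prod>j\<in>UNIV. if j = i then g i else 1)"
    by (rule prod.cong) (auto simp: lookup_single when_def)
  thus ?thesis by (simp add: var_def subst_hom_single hom_1)
qed

lemma subst_hom_subst_hom:
  "subst_hom h g (subst_hom (Poly_Mapping.single 0) f p) = subst_hom h (\<lambda>i. subst_hom h g (f i)) p"
proof (induction p rule: mpoly_induct)
  interpret const: coeff_hom "Poly_Mapping.single 0 :: 'a \<Rightarrow> ('d, 'a) mpoly"
    by standard (simp_all add: single_add mult_single)
  case (monomial e c)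
  show ?case
    by (simp add: const.subst_hom_single subst_hom_single subst_hom_mult subst_hom_prod
        subst_hom_power subst_hom_const)
next
  interpret const: coeff_hom "Poly_Mapping.single 0 :: 'a \<Rightarrow> ('d, 'a) mpoly"
    by standard (simp_all add: single_add mult_single)
  case (add p q)
  thus ?case by (simp add: const.subst_hom_add subst_hom_add)
qed

end

interpretation const: coeff_hom "Poly_Mapping.single 0 :: 'a::field \<Rightarrow> ('v, 'a) mpoly"
  by standard (simp_all add: single_add mult_single)

interpretation ident: coeff_hom "\<lambda>x::'a::field. x"
  by standard simp_all

lemma eval_eq_subst_hom: "eval p P = subst_hom (\<lambda>x. x) P p"
  by (simp add: eval_def subst_hom_def)

lemma prod_var_power:
  fixes e :: "'v::finite \<Rightarrow>\<^sub>0 nat"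
  shows "(\<Prod>i\<in>UNIV. var i ^ Poly_Mapping.lookup e i) = (Poly_Mapping.single e 1 :: ('v, 'a::field) mpoly)"
proof -
  have pow: "var i ^ k = (Poly_Mapping.single (Poly_Mapping.single i k) 1 :: ('v, 'a) mpoly)" for i k
    by (induction k) (simp_all add: var_def mult_single flip: single_add)
  have "(\<Prod>i\<in>S. var i ^ Poly_Mapping.lookup e i) =
      (Poly_Mapping.single (\<Sum>i\<in>S. Poly_Mapping.single i (Poly_Mapping.lookup e i)) 1 :: ('v, 'a) mpoly)" for S
    by (induction S rule: infinite_finite_induct) (simp_all add: pow mult_single)
  moreover have "(\<Sum>i\<in>UNIV. Poly_Mapping.single i (Poly_Mapping.lookup e i)) = e"
    by (rule poly_mapping_eqI) (simp add: lookup_sum lookup_single when_def)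
  ultimately show ?thesis by simp
qed

lemma subst_hom_ident: "subst_hom (Poly_Mapping.single 0) var p = p"
proof (induction p rule: mpoly_induct)
  case (monomial e c)
  show ?case by (simp add: const.subst_hom_single prod_var_power mult_single)
qed (simp add: const.subst_hom_add)

lemma forms_subst_hom:
  assumes "p \<in> forms t" and "\<And>i. g i \<in> forms (Suc 0)"
  shows "subst_hom (Poly_Mapping.single 0) g p \<in> forms t"
  unfolding subst_hom_def
proof (rule forms_sum)
  fix e assume "e \<in> Poly_Mapping.keys p"
  hence "mdeg e = t" using assms(1) by (simp add: forms_iff)
  moreover have "(\<Prod>i\<in>UNIV. g i ^ Poly_Mapping.lookup e i) \<in> forms (mdeg e)"
    unfolding mdeg_def using forms_power[OF assms(2)] by (intro forms_prod) simp
  ultimately show "Poly_Mapping.single 0 (Poly_Mapping.lookup p e) *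
      (\<Prod>i\<in>UNIV. g i ^ Poly_Mapping.lookup e i) \<in> forms t"
    using forms_scale by simp
qed

lemma eval_scale_point:
  assumes "p \<in> forms t"
  shows "eval p (\<lambda>i. k * P i) = k ^ t * eval p P"
proof -
  have mon: "(\<Prod>i\<in>UNIV. (k * P i) ^ Poly_Mapping.lookup e i) =
      k ^ t * (\<Prod>i\<in>UNIV. P i ^ Poly_Mapping.lookup e i)" if "e \<in> Poly_Mapping.keys p" for e
    using assms that by (auto simp: forms_def power_mult_distrib prod.distrib simp flip: power_sum)
  show ?thesis
    unfolding eval_def sum_distrib_left by (rule sum.cong) (simp_all add: mon)
qed

lemma eval_unit_vector:
  assumes "p \<in> forms t"
  shows "eval p (\<lambda>i. if i = a then 1 else 0) = Poly_Mapping.lookup p (Poly_Mapping.single a t)"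
proof -
  have mon: "(\<Prod>i\<in>UNIV. (if i = a then 1 else 0) ^ Poly_Mapping.lookup e i) =
      (if e = Poly_Mapping.single a t then 1 else (0::'b))" if "e \<in> Poly_Mapping.keys p" for e
  proof (cases "mdeg_off a e = 0")
    case True
    have "(\<Prod>i\<in>UNIV. (if i = a then 1 else 0) ^ Poly_Mapping.lookup e i) = (1::'b)"
      by (rule prod.neutral) (use True in \<open>auto simp: mdeg_off_def\<close>)
    thus ?thesis using True assms that mdeg_off_eq_0_iff[of a e] by (simp add: forms_iff)
  next
    case False
    then obtain i where "i \<noteq> a" "Poly_Mapping.lookup e i \<noteq> 0"
      by (auto simp: mdeg_off_def)
    hence "(\<Prod>i\<in>UNIV. (if i = a then 1 else 0) ^ Poly_Mapping.lookup e i) = (0::'b)"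
      by (intro prod_zero) (auto intro!: bexI[of _ i])
    thus ?thesis using False by auto
  qed
  have "eval p (\<lambda>i. if i = a then 1 else 0) =
      (\<Sum>e\<in>Poly_Mapping.keys p. if e = Poly_Mapping.single a t then Poly_Mapping.lookup p e else 0)"
    unfolding eval_def by (rule sum.cong) (simp_all add: mon)
  thus ?thesis by (auto simp: in_keys_iff)
qed

section \<open>General points\<close>

text \<open>
  Over an infinite field, a linear combination of distinct monomials in the variables of \<open>A\<close> that
  vanishes everywhere is trivial: fixing all variables but one leaves a univariate polynomial.
\<close>

lemma monomials_linearly_independent:
  fixes E :: "('v::finite \<Rightarrow>\<^sub>0 nat) set" and c :: "('v \<Rightarrow>\<^sub>0 nat) \<Rightarrow> 'a::field"
  assumes inf: "infinite (UNIV :: 'a set)" and "finite A" and "finite E"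
    and "\<And>e e'. e \<in> E \<Longrightarrow> e' \<in> E \<Longrightarrow>
      (\<forall>i\<in>A. Poly_Mapping.lookup e i = Poly_Mapping.lookup e' i) \<Longrightarrow> e = e'"
    and "\<And>P. (\<Sum>e\<in>E. c e * (\<Prod>i\<in>A. P i ^ Poly_Mapping.lookup e i)) = 0"
    and "e \<in> E"
  shows "c e = 0"
  using assms(2-)
proof (induction A arbitrary: E e rule: finite_induct)
  case empty
  have "E = {e}" using empty.prems(2)[of _ e] empty.prems(4) by blast
  thus ?case using empty.prems(3) by simp
next
  case (insert a A)
  let ?k = "Poly_Mapping.lookup e a"
  let ?E = "{e' \<in> E. Poly_Mapping.lookup e' a = ?k}"
  have "(\<Sum>e'\<in>?E. c e' * (\<Prod>i\<in>A. P i ^ Poly_Mapping.lookup e' i)) = 0" for P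
  proof -
    define q where "q = (\<Sum>e'\<in>E. monom (c e' * (\<Prod>i\<in>A. P i ^ Poly_Mapping.lookup e' i))
      (Poly_Mapping.lookup e' a))"
    have "poly q s = 0" for s
    proof -
      have "(\<Prod>i\<in>A. (P(a := s)) i ^ Poly_Mapping.lookup e' i) =
          (\<Prod>i\<in>A. P i ^ Poly_Mapping.lookup e' i)" for e'
        by (rule prod.cong) (use insert.hyps in auto)
      thus ?thesis
        using insert.prems(3)[of "P(a := s)"] insert.hyps
        by (simp add: q_def poly_sum poly_monom mult.left_commute mult.commute[of _ "s ^ _"])
    qed
    hence "q = 0" using poly_roots_finite[of q] inf by auto
    hence "coeff q ?k = 0" by simp
    moreover have "coeff q ?k = (\<Sum>e'\<in>?E. c e' * (\<Prod>i\<in>A. P i ^ Poly_Mapping.lookup e' i))"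
      using insert.prems(1) by (simp add: q_def coeff_sum sum.inter_filter)
    ultimately show ?thesis by simp
  qed
  moreover have "e1 = e2" if "e1 \<in> ?E" "e2 \<in> ?E"
      "\<forall>i\<in>A. Poly_Mapping.lookup e1 i = Poly_Mapping.lookup e2 i" for e1 e2
    by (rule insert.prems(2)) (use that in auto)
  moreover have "finite ?E" "e \<in> ?E" using insert.prems(1,4) by auto
  ultimately show ?case by (intro insert.IH[of ?E e])
qed

lemma nonzero_poly_nonvanishing:
  fixes p :: "('v::finite, 'a::field) mpoly"
  assumes "infinite (UNIV :: 'a set)" and "p \<noteq> 0"
  shows "\<exists>P. eval p P \<noteq> 0"
proof (rule ccontr)
  assume "\<nexists>P. eval p P \<noteq> 0"
  hence "Poly_Mapping.lookup p e = 0" if "e \<in> Poly_Mapping.keys p" for e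
    using that
    by (intro monomials_linearly_independent[where c = "Poly_Mapping.lookup p",
          OF assms(1), of UNIV "Poly_Mapping.keys p"])
      (auto simp: eval_def intro: poly_mapping_eqI)
  hence "p = 0" by (metis poly_mapping_eqI in_keys_iff lookup_zero)
  with assms(2) show False by simp
qed

text \<open>Restricted to the line through \<open>P\<close> and \<open>Q\<close>, a polynomial function is a univariate one.\<close>

lemma eval_on_line:
  fixes F :: "('v::finite, 'a::field) mpoly"
  shows "\<exists>f. \<forall>s. poly f s = eval F (\<lambda>i. P i + s * (Q i - P i))"
proof (intro exI allI)
  fix s
  show "poly (subst_hom (\<lambda>x. [:x:]) (\<lambda>i. [:P i, Q i - P i:]) F) s =
      eval F (\<lambda>i. P i + s * (Q i - P i))"
    by (simp add: subst_hom_def eval_def poly_sum poly_prod)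
qed

lemma for_general_point_meet:
  assumes inf: "infinite (UNIV :: 'a::field set)"
    and "for_general_point (A :: ('v::finite \<Rightarrow> 'a) \<Rightarrow> bool)" and "for_general_point B"
  shows "\<exists>P. A P \<and> B P"
proof -
  obtain S U where S: "U = {P. P \<noteq> (\<lambda>_. 0) \<and> (\<exists>F\<in>S. eval F P \<noteq> 0)}"
      "U \<noteq> {}" "\<forall>P\<in>U. A P"
    using assms(2) unfolding for_general_point_def zariski_open_def by blast
  obtain T V where T: "V = {P. P \<noteq> (\<lambda>_. 0) \<and> (\<exists>F\<in>T. eval F P \<noteq> 0)}"
      "V \<noteq> {}" "\<forall>P\<in>V. B P"
    using assms(3) unfolding for_general_point_def zariski_open_def by blast
  obtain P F where P: "P \<noteq> (\<lambda>_. 0)" "F \<in> S" "eval F P \<noteq> 0" using S by blast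
  obtain Q G where Q: "Q \<noteq> (\<lambda>_. 0)" "G \<in> T" "eval G Q \<noteq> 0" using T by blast
  obtain j where j: "P j \<noteq> 0" using P(1) by auto
  define L where "L = (\<lambda>s i. P i + s * (Q i - P i))"
  have L: "L 0 = P" "L 1 = Q" by (auto simp: L_def)
  obtain f where f: "\<And>s. poly f s = eval F (L s)"
    using eval_on_line[of F P Q] by (auto simp: L_def)
  obtain g where g: "\<And>s. poly g s = eval G (L s)"
    using eval_on_line[of G P Q] by (auto simp: L_def)
  define l where "l = [:P j, Q j - P j:]"
  have l: "poly l s = L s j" for s by (simp add: l_def L_def)
  \<comment> \<open>The factor \<open>l\<close> keeps the chosen point of the line away from the zero vector.\<close>
  have "f \<noteq> 0" using f[of 0] P(3) L by auto
  moreover have "g \<noteq> 0" using g[of 1] Q(3) L by auto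
  moreover have "l \<noteq> 0" using j by (simp add: l_def)
  ultimately have "f * g * l \<noteq> 0" by simp
  then obtain s where "poly (f * g * l) s \<noteq> 0"
    using ex_new_if_finite[OF inf poly_roots_finite] by blast
  hence "eval F (L s) \<noteq> 0" "eval G (L s) \<noteq> 0" "L s j \<noteq> 0" by (auto simp: f g l)
  moreover from this(3) have "L s \<noteq> (\<lambda>_. 0)" by auto
  ultimately have "L s \<in> U" "L s \<in> V" using S(1) T(1) P(2) Q(2) by auto
  thus ?thesis using S(3) T(3) by blast
qed

lemma adim_eqI:
  fixes X :: "('v::finite, 'a::field) mpoly set"
  assumes "infinite (UNIV :: 'a set)"
    and "for_general_point (\<lambda>P. mpoly.dim (X \<inter> ideal_pow (point_ideal P) m \<inter> forms t) = a)"
  shows "adim X t m = a"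
  unfolding adim_def
proof (rule the_equality)
  fix b assume "for_general_point (\<lambda>P. mpoly.dim (X \<inter> ideal_pow (point_ideal P) m \<inter> forms t) = b)"
  from for_general_point_meet[OF assms(1) this assms(2)] show "b = a" by auto
qed (rule assms(2))

lemma for_general_point_off_hypersurface:
  fixes F :: "('v::finite, 'a::field) mpoly"
  assumes "infinite (UNIV :: 'a set)" and "F \<in> forms e" and "e \<ge> 1" and "F \<noteq> 0"
    and "\<And>P. P \<noteq> (\<lambda>_. 0) \<Longrightarrow> eval F P \<noteq> 0 \<Longrightarrow> Q P"
  shows "for_general_point Q"
proof -
  obtain P where P: "eval F P \<noteq> 0" using nonzero_poly_nonvanishing assms(1,4) by blast
  have "P \<noteq> (\<lambda>_. 0)"
  proof
    assume "P = (\<lambda>_. 0)"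
    thus False using P eval_scale_point[OF assms(2), of 0 P] assms(3) by (simp add: zero_power)
  qed
  moreover have "zariski_open {P. P \<noteq> (\<lambda>_. 0) \<and> (\<exists>G\<in>{F}. eval G P \<noteq> 0)}"
    unfolding zariski_open_def using assms(2) by blast
  ultimately show ?thesis
    unfolding for_general_point_def using P assms(5)
    by (intro exI[of _ "{P. P \<noteq> (\<lambda>_. 0) \<and> (\<exists>G\<in>{F}. eval G P \<noteq> 0)}"]) auto
qed

section \<open>Powers of the ideal of a point\<close>

text \<open>
  The shear adds \<open>c i\<close> times the variable \<open>a\<close> to each variable \<open>i \<noteq> a\<close>; the value \<open>c a\<close> is ignored.
\<close>

definition shear :: "'v \<Rightarrow> ('v \<Rightarrow> 'a) \<Rightarrow> ('v::finite, 'a::field) mpoly \<Rightarrow> ('v, 'a) mpoly" where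
  "shear a c = subst_hom (Poly_Mapping.single 0)
     (\<lambda>i. if i = a then var a else var i + Poly_Mapping.single 0 (c i) * var a)"

lemma shear_0: "shear a c 0 = 0"
  and shear_add: "shear a c (p + q) = shear a c p + shear a c q"
  and shear_mult: "shear a c (p * q) = shear a c p * shear a c q"
  and shear_const: "shear a c (Poly_Mapping.single 0 x) = Poly_Mapping.single 0 x"
  by (simp_all add: shear_def const.subst_hom_0 const.subst_hom_add
      const.subst_hom_mult const.subst_hom_const)

lemma shear_diff: "shear a c (p - q) = shear a c p - shear a c q"
  using shear_add[of a c "p - q" q] by (simp add: algebra_simps)

lemma shear_var:
  "shear a c (var i) = (if i = a then var a else var i + Poly_Mapping.single 0 (c i) * var a)"
  by (simp add: shear_def const.subst_hom_var)

lemma shear_forms: "p \<in> forms t \<Longrightarrow> shear a c p \<in> forms t"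
  unfolding shear_def by (intro forms_subst_hom) (auto intro: forms_add forms_scale forms_var)

lemma shear_inverse: "shear a c (shear a (\<lambda>i. - c i) p) = p"
proof -
  have "shear a c (shear a (\<lambda>i. - c i) p) = subst_hom (Poly_Mapping.single 0)
      (\<lambda>i. shear a c (if i = a then var a else var i + Poly_Mapping.single 0 (- c i) * var a)) p"
    unfolding shear_def by (rule const.subst_hom_subst_hom)
  also have "(\<lambda>i. shear a c (if i = a then var a else var i + Poly_Mapping.single 0 (- c i) * var a)) = var"
    by (auto simp: fun_eq_iff shear_add shear_diff shear_mult shear_const shear_var single_uminus)
  finally show ?thesis by (simp add: subst_hom_ident)
qed

lemma shear_inverse': "shear a (\<lambda>i. - c i) (shear a c p) = p"
  using shear_inverse[of a "\<lambda>i. - c i" p] by simp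

lemma eval_shear:
  "eval (shear a c p) P = eval p (\<lambda>i. if i = a then P a else P i + c i * P a)"
proof -
  have "(\<lambda>i. subst_hom (\<lambda>x. x) P (if i = a then var a else var i + Poly_Mapping.single 0 (c i) * var a)) =
      (\<lambda>i. if i = a then P a else P i + c i * P a)"
    by (auto simp: ident.subst_hom_add ident.subst_hom_mult ident.subst_hom_const ident.subst_hom_var)
  thus ?thesis by (simp add: eval_eq_subst_hom shear_def ident.subst_hom_subst_hom)
qed

text \<open>The shear with \<open>c i = P i / P a\<close> moves the point \<open>P\<close> to the unit vector of \<open>a\<close>.\<close>

lemma lookup_shear_point:
  assumes "p \<in> forms t" and "P a \<noteq> 0"
  shows "Poly_Mapping.lookup (shear a (\<lambda>i. P i / P a) p) (Poly_Mapping.single a t) =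
    (1 / P a) ^ t * eval p P"
proof -
  let ?c = "\<lambda>i. P i / P a"
  have "Poly_Mapping.lookup (shear a ?c p) (Poly_Mapping.single a t) =
      eval (shear a ?c p) (\<lambda>i. if i = a then 1 else 0)"
    using eval_unit_vector[OF shear_forms[OF assms(1)]] by simp
  also have "\<dots> = eval p (\<lambda>i. (1 / P a) * P i)"
    unfolding eval_shear by (rule arg_cong[of _ _ "eval p"]) (use assms(2) in auto)
  also have "\<dots> = (1 / P a) ^ t * eval p P" by (rule eval_scale_point[OF assms(1)])
  finally show ?thesis .
qed

text \<open>
  The \<open>m\<close>-th power of the ideal of the unit vector of \<open>a\<close>, that is, of the ideal generated by the
  variables other than \<open>a\<close>. It is described by its monomials.
\<close>

definition order_ideal :: "'v \<Rightarrow> nat \<Rightarrow> ('v::finite, 'a::field) mpoly set" where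
  "order_ideal a m = {p. \<forall>e\<in>Poly_Mapping.keys p. m \<le> mdeg_off a e}"

lemma order_ideal_mult:
  "p \<in> order_ideal a k \<Longrightarrow> q \<in> order_ideal a l \<Longrightarrow> p * q \<in> order_ideal a (k + l)"
  unfolding order_ideal_def using keys_mult[of p q] by (fastforce simp: mdeg_off_add)

lemma order_ideal_0: "order_ideal a 0 = UNIV"
  by (simp add: order_ideal_def)

lemma ideal_order_ideal: "ideal.subspace (order_ideal a m)"
proof (rule ideal.subspaceI)
  show "0 \<in> order_ideal a m" by (simp add: order_ideal_def)
  show "p + q \<in> order_ideal a m" if "p \<in> order_ideal a m" "q \<in> order_ideal a m" for p q
    using that Poly_Mapping.keys_add[of p q] unfolding order_ideal_def by blast
  show "p * q \<in> order_ideal a m" if "q \<in> order_ideal a m" for p q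
    using order_ideal_mult[of p a 0 q m] that by (simp add: order_ideal_0)
qed

lemma ideal_shear_preimage:
  assumes "ideal.subspace J"
  shows "ideal.subspace {p. shear a c p \<in> J}"
  using assms by (auto simp: ideal.subspace_def shear_0 shear_add shear_mult)

lemma shear_point_ideal:
  assumes "P a \<noteq> 0" and "p \<in> point_ideal P"
  shows "shear a (\<lambda>i. P i / P a) p \<in> order_ideal a 1"
proof -
  let ?c = "\<lambda>i. P i / P a"
  have "{F. (\<exists>t. F \<in> forms t) \<and> eval F P = 0} \<subseteq> {p. shear a ?c p \<in> order_ideal a 1}"
  proof clarify
    fix F t assume F: "F \<in> forms t" "eval F P = 0"
    have "mdeg_off a e \<noteq> 0" if "e \<in> Poly_Mapping.keys (shear a ?c F)" for e
    proof
      assume "mdeg_off a e = 0"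
      hence "e = Poly_Mapping.single a t"
        using shear_forms[OF F(1), of a ?c] that by (simp add: mdeg_off_eq_0_iff forms_iff)
      thus False using lookup_shear_point[where P = P, OF F(1) assms(1)] F(2) that
        by (simp add: in_keys_iff)
    qed
    thus "shear a ?c F \<in> order_ideal a 1" by (auto simp: order_ideal_def Suc_le_eq)
  qed
  hence "point_ideal P \<subseteq> {p. shear a ?c p \<in> order_ideal a 1}"
    unfolding point_ideal_def
    by (intro ideal.span_minimal ideal_shear_preimage ideal_order_ideal)
  thus ?thesis using assms(2) by blast
qed

lemma ideal_ideal_pow: "ideal.subspace (ideal_pow I m)"
  by (cases m) (simp_all add: ideal.subspace_UNIV ideal.subspace_span)

lemma shear_ideal_pow:
  assumes "P a \<noteq> 0" and "p \<in> ideal_pow (point_ideal P) m"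
  shows "shear a (\<lambda>i. P i / P a) p \<in> order_ideal a m"
  using assms(2)
proof (induction m arbitrary: p)
  case 0
  show ?case by (simp add: order_ideal_0)
next
  case (Suc m)
  have "ideal_pow (point_ideal P) (Suc m) \<subseteq> {p. shear a (\<lambda>i. P i / P a) p \<in> order_ideal a (Suc m)}"
    unfolding ideal_pow.simps
  proof (rule ideal.span_minimal)
    show "{p * q |p q. p \<in> point_ideal P \<and> q \<in> ideal_pow (point_ideal P) m}
        \<subseteq> {p. shear a (\<lambda>i. P i / P a) p \<in> order_ideal a (Suc m)}"
      using order_ideal_mult[OF shear_point_ideal[where P = P, OF assms(1)] Suc.IH] by (auto simp: shear_mult)
  qed (intro ideal_shear_preimage ideal_order_ideal)
  thus ?case using Suc.prems by blast
qed

text \<open>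
  The inverse shear turns each variable other than \<open>a\<close> into a linear form vanishing at \<open>P\<close>.
\<close>

lemma inverse_shear_monomial_mem:
  assumes "P a \<noteq> 0" and "k \<le> mdeg_off a e"
  shows "shear a (\<lambda>i. - (P i / P a)) (Poly_Mapping.single e x) \<in> ideal_pow (point_ideal P) k"
  using assms(2)
proof (induction k arbitrary: e)
  case 0
  show ?case by simp
next
  case (Suc k)
  let ?c = "\<lambda>i. - (P i / P a)"
  obtain j where j: "j \<noteq> a" "Poly_Mapping.lookup e j \<noteq> 0"
  proof -
    have "mdeg_off a e \<noteq> 0" using Suc.prems by simp
    thus ?thesis using that by (auto simp: mdeg_off_def)
  qed
  define e' where "e' = e - Poly_Mapping.single j 1"
  have e: "e = Poly_Mapping.single j 1 + e'"
    by (rule poly_mapping_eqI)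
      (use j in \<open>auto simp: e'_def lookup_add lookup_minus lookup_single when_def\<close>)
  have "k \<le> mdeg_off a e'"
    using Suc.prems j by (simp add: e mdeg_off_add mdeg_off_single_other)
  hence IH: "shear a ?c (Poly_Mapping.single e' x) \<in> ideal_pow (point_ideal P) k"
    by (rule Suc.IH)
  have "eval (shear a ?c (var j)) P = 0"
    unfolding eval_shear using j assms(1) by (simp add: eval_eq_subst_hom ident.subst_hom_var)
  hence "shear a ?c (var j) \<in> point_ideal P"
    unfolding point_ideal_def using shear_forms[OF forms_var] by (intro ideal.span_base) blast
  hence "shear a ?c (var j) * shear a ?c (Poly_Mapping.single e' x) \<in> ideal_pow (point_ideal P) (Suc k)"
    using IH by (auto intro!: ideal.span_base)
  moreover have "Poly_Mapping.single e x = var j * Poly_Mapping.single e' x"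
    by (simp add: e var_def mult_single)
  ultimately show ?case by (simp only: shear_mult)
qed

text \<open>
  Membership in a power of the ideal of \<open>P\<close> is the vanishing of some coefficients after the shear.
\<close>

lemma ideal_pow_point_ideal_iff:
  assumes "P a \<noteq> 0"
  shows "p \<in> ideal_pow (point_ideal P) m \<longleftrightarrow> shear a (\<lambda>i. P i / P a) p \<in> order_ideal a m"
proof
  let ?c = "\<lambda>i. P i / P a" and ?I = "ideal_pow (point_ideal P) m"
  assume h: "shear a ?c p \<in> order_ideal a m"
  have I: "ideal.subspace ?I" by (rule ideal_ideal_pow)
  let ?q = "shear a ?c p"
  have "shear a (\<lambda>i. - ?c i) (\<Sum>e\<in>S. Poly_Mapping.single e (Poly_Mapping.lookup ?q e)) \<in> ?I"
    if "S \<subseteq> Poly_Mapping.keys ?q" for S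
    using finite_subset[OF that finite_keys] that
  proof (induction S rule: finite_induct)
    case empty
    show ?case using I by (simp add: shear_0 ideal.subspace_0)
  next
    case (insert e S)
    have "shear a (\<lambda>i. - ?c i) (Poly_Mapping.single e (Poly_Mapping.lookup ?q e)) \<in> ?I"
      using insert.prems h by (intro inverse_shear_monomial_mem[where P = P, OF assms]) (auto simp: order_ideal_def)
    thus ?case using insert I by (simp add: shear_add ideal.subspace_add)
  qed
  from this[OF subset_refl] show "p \<in> ?I" by (simp only: mpoly_sum_monomials shear_inverse')
qed (rule shear_ideal_pow[where P = P, OF assms])

section \<open>Dimension count\<close>

lemma (in vector_space) dim_kernel_functional:
  fixes l :: "'b \<Rightarrow> 'a"
  assumes V: "subspace V" and T: "finite T" "V \<subseteq> span T"
    and add: "\<And>x y. l (x + y) = l x + l y" and scale: "\<And>c x. l (c *s x) = c * l x"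
    and g: "g \<in> V" "l g \<noteq> 0"
  shows "dim V = Suc (dim {v \<in> V. l v = 0})"
proof -
  let ?V0 = "{v \<in> V. l v = 0}"
  have l0: "l 0 = 0" using scale[of 0 0] by simp
  have V0: "subspace ?V0"
    using V by (auto simp: subspace_def add scale l0)
  obtain A where A: "A \<subseteq> ?V0" "independent A" "?V0 \<subseteq> span A" "card A = dim ?V0"
    using basis_exists[of ?V0] by blast
  have "finite A"
    using independent_span_bound[OF T(1) A(2)] A(1) T(2) by blast
  have "span A \<subseteq> ?V0" using A(1) V0 by (rule span_minimal)
  hence gA: "g \<notin> span A" using g by blast
  have "v \<in> span (insert g A)" if v: "v \<in> V" for v
  proof -
    let ?k = "l v / l g"
    have dec: "l v = l (v - ?k *s g) + l (?k *s g)" by (subst add[symmetric]) simp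
    have "v - ?k *s g \<in> ?V0"
      using V v g dec by (auto simp: scale subspace_diff subspace_scale)
    hence "v - ?k *s g \<in> span (insert g A)"
      using A(3) span_mono[of A "insert g A"] by blast
    moreover have "?k *s g \<in> span (insert g A)" by (simp add: span_base span_scale)
    ultimately show ?thesis using span_add by fastforce
  qed
  moreover have "independent (insert g A)" using gA A(2) by (rule independent_insertI)
  ultimately have "dim V = card (insert g A)"
    using A(1) g(1) by (intro dim_unique) auto
  also have "\<dots> = Suc (card A)"
    using \<open>finite A\<close> gA span_base by (auto simp: card_insert_if)
  finally show ?thesis using A(4) by simp
qed

text \<open>
  A finite family of functionals, ranked by \<open>k\<close>, cuts down the dimension by its cardinality as
  soon as it is triangular with respect to some family of vectors.
\<close>

lemma (in vector_space) dim_kernel_triangular: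
  fixes l :: "'i \<Rightarrow> 'b \<Rightarrow> 'a" and k :: "'i \<Rightarrow> nat"
  assumes V: "subspace V" and T: "finite T" "V \<subseteq> span T"
    and add: "\<And>i x y. l i (x + y) = l i x + l i y"
    and scale: "\<And>i c x. l i (c *s x) = c * l i x"
    and "finite B"
    and tri: "\<And>b. b \<in> B \<Longrightarrow> \<exists>g\<in>V. l b g \<noteq> 0 \<and> (\<forall>b'\<in>B. b' \<noteq> b \<longrightarrow> k b' \<le> k b \<longrightarrow> l b' g = 0)"
  shows "dim V = dim {v \<in> V. \<forall>b\<in>B. l b v = 0} + card B"
  using assms(6,7)
proof (induction B rule: finite_ranking_induct[where f = k])
  case empty
  show ?case by simp
next
  case (insert b B)
  show ?case
  proof (cases "b \<in> B")
    case True
    hence "insert b B = B" by auto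
    thus ?thesis using insert.IH insert.prems by simp
  next
    case False
    let ?W = "{v \<in> V. \<forall>b\<in>B. l b v = 0}"
    have IH: "dim V = dim ?W + card B"
    proof (rule insert.IH)
      fix b' assume "b' \<in> B"
      thus "\<exists>g\<in>V. l b' g \<noteq> 0 \<and> (\<forall>b''\<in>B. b'' \<noteq> b' \<longrightarrow> k b'' \<le> k b' \<longrightarrow> l b'' g = 0)"
        using insert.prems[of b'] by blast
    qed
    obtain g where g: "g \<in> V" "l b g \<noteq> 0"
        "\<forall>b'\<in>insert b B. b' \<noteq> b \<longrightarrow> k b' \<le> k b \<longrightarrow> l b' g = 0"
      using insert.prems[of b] by blast
    have l0: "l i 0 = 0" for i using scale[of i 0 0] by simp
    have "subspace ?W" using V by (auto simp: subspace_def add scale l0)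
    moreover have "g \<in> ?W" using g insert.hyps False by auto
    ultimately have "dim ?W = Suc (dim {v \<in> ?W. l b v = 0})"
      using T g(2) by (intro dim_kernel_functional[where T = T]) (auto simp: add scale)
    moreover have "{v \<in> ?W. l b v = 0} = {v \<in> V. \<forall>b\<in>insert b B. l b v = 0}" by auto
    ultimately show ?thesis using IH False insert.hyps by simp
  qed
qed

lemma forms_subset_span:
  "forms t \<subseteq> mpoly.span ((\<lambda>e. Poly_Mapping.single e (1::'a::field)) ` {e :: 'v::finite \<Rightarrow>\<^sub>0 nat. mdeg e = t})"
proof
  fix p :: "('v, 'a) mpoly"
  assume p: "p \<in> forms t"
  let ?S = "mpoly.span ((\<lambda>e. Poly_Mapping.single e (1::'a)) ` {e :: 'v \<Rightarrow>\<^sub>0 nat. mdeg e = t})"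
  have "(\<Sum>e\<in>Poly_Mapping.keys p. Poly_Mapping.single e (Poly_Mapping.lookup p e)) \<in> ?S"
  proof (rule mpoly.span_sum)
    fix e assume "e \<in> Poly_Mapping.keys p"
    hence "Poly_Mapping.single e 1 \<in> ?S"
      using p by (intro mpoly.span_base) (auto simp: forms_iff)
    from mpoly.span_scale[OF this, of "Poly_Mapping.lookup p e"]
    show "Poly_Mapping.single e (Poly_Mapping.lookup p e) \<in> ?S" by (simp add: mult_single)
  qed
  thus "p \<in> ?S" by (simp only: mpoly_sum_monomials)
qed

lemma subspace_ideal_inter_forms:
  assumes "ideal.subspace X"
  shows "mpoly.subspace (X \<inter> forms t)"
  using assms by (auto simp: mpoly.subspace_def ideal.subspace_def intro: forms_add forms_scale)

lemma ideal_pow_inter_forms: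
  assumes "P a \<noteq> 0"
  shows "ideal_pow (point_ideal P) m \<inter> forms t = {p \<in> forms t.
    \<forall>b\<in>{e. mdeg e = t \<and> mdeg_off a e < m}. Poly_Mapping.lookup (shear a (\<lambda>i. P i / P a) p) b = 0}"
proof -
  let ?c = "\<lambda>i. P i / P a"
  have "shear a ?c p \<in> order_ideal a m \<longleftrightarrow>
      (\<forall>b\<in>{e. mdeg e = t \<and> mdeg_off a e < m}. Poly_Mapping.lookup (shear a ?c p) b = 0)"
    if "p \<in> forms t" for p
    using shear_forms[OF that, of a ?c] unfolding forms_iff order_ideal_def
    by (fastforce simp: in_keys_iff not_le[symmetric])
  thus ?thesis by (auto simp: ideal_pow_point_ideal_iff[where P = P, OF assms])
qed

text \<open>
  The case of degrees below the multiplicity, where all coefficients are among the vanishing ones.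
\<close>

lemma dim_below_multiplicity:
  fixes X :: "('v::finite, 'a::field) mpoly set"
  assumes "P \<noteq> (\<lambda>_. 0)" and "t < m"
  shows "mpoly.dim (X \<inter> ideal_pow (point_ideal P) m \<inter> forms t) = 0"
proof -
  obtain a where a: "P a \<noteq> 0" using assms(1) by auto
  let ?c = "\<lambda>i. P i / P a"
  have "p = 0" if p: "p \<in> ideal_pow (point_ideal P) m \<inter> forms t" for p
  proof -
    have "e \<notin> Poly_Mapping.keys (shear a ?c p)" for e
    proof
      assume e: "e \<in> Poly_Mapping.keys (shear a ?c p)"
      have "mdeg e = t" using shear_forms[of p t a ?c] p e by (simp add: forms_iff)
      moreover have "m \<le> mdeg_off a e"
        using p e a by (auto simp: ideal_pow_point_ideal_iff order_ideal_def)
      ultimately show False using mdeg_split[of e a] assms(2) by simp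
    qed
    hence "shear a ?c p = 0" by (metis in_keys_iff lookup_zero poly_mapping_eqI)
    thus "p = 0" using shear_inverse'[of a ?c p] by (simp add: shear_0)
  qed
  hence "X \<inter> ideal_pow (point_ideal P) m \<inter> forms t \<subseteq> mpoly.span {}" by auto
  thus ?thesis by (metis card.empty finite.emptyI mpoly.dim_le_card le_zero_eq)
qed

text \<open>
  Since \<open>t \<ge> d + m\<close>, a monomial \<open>b\<close> of degree \<open>t\<close> with \<open>mdeg_off a b < m\<close> has exponent at least \<open>d + 1\<close> at \<open>a\<close>. After
  the shear, the product of \<open>F\<close> and \<open>b\<close> divided by \<open>a\<^bsup>d+1\<^esup>\<close> has a nonzero coefficient at \<open>b\<close>, since \<open>F\<close>
  does not vanish at \<open>P\<close>, and its other monomials have larger degree in the variables other than \<open>a\<close>.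
\<close>

lemma dim_fat_point:
  fixes X :: "('v::finite, 'a::field) mpoly set"
  assumes X: "ideal.subspace X" and F: "F \<in> forms (d + 1)" "F \<in> X" "eval F P \<noteq> 0"
    and P: "P \<noteq> (\<lambda>_. 0)" and m: "m \<ge> 1" and t: "t \<ge> d + m"
  shows "int (mpoly.dim (X \<inter> ideal_pow (point_ideal P) m \<inter> forms t)) = vdim X t m"
proof -
  obtain a where a: "P a \<noteq> 0" using P by auto
  define c where "c = (\<lambda>i. P i / P a)"
  define B where "B = {e :: 'v \<Rightarrow>\<^sub>0 nat. mdeg e = t \<and> mdeg_off a e < m}"
  define top where "top = Poly_Mapping.single a (d + 1)"
  have F_top: "Poly_Mapping.lookup (shear a c F) top \<noteq> 0"
    unfolding top_def c_def using lookup_shear_point[where P = P, OF F(1) a] F(3) a by simp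
  have "mpoly.dim (X \<inter> forms t) = mpoly.dim {p \<in> X \<inter> forms t.
      \<forall>b\<in>B. Poly_Mapping.lookup (shear a c p) b = 0} + card B"
  proof (rule mpoly.dim_kernel_triangular[where k = "mdeg_off a"])
    show "mpoly.subspace (X \<inter> forms t)" by (rule subspace_ideal_inter_forms[OF X])
    show "finite ((\<lambda>e. Poly_Mapping.single e (1::'a)) ` {e :: 'v \<Rightarrow>\<^sub>0 nat. mdeg e = t})"
      by (intro finite_imageI finite_mdeg)
    show "X \<inter> forms t \<subseteq> mpoly.span ((\<lambda>e. Poly_Mapping.single e (1::'a)) ` {e :: 'v \<Rightarrow>\<^sub>0 nat. mdeg e = t})"
      using forms_subset_span by blast
    show "finite B" unfolding B_def by (rule finite_subset[OF _ finite_mdeg[of t]]) auto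
    fix b assume b: "b \<in> B"
    define b' where "b' = b - top"
    have "Poly_Mapping.lookup b a \<ge> d + 1"
      using b t mdeg_split[of b a] by (simp add: B_def)
    hence b_split: "b = b' + top"
      by (intro poly_mapping_eqI)
        (auto simp: b'_def top_def lookup_add lookup_minus lookup_single when_def)
    have deg_b': "mdeg b' + (d + 1) = t" and off_b': "mdeg_off a b' = mdeg_off a b"
      using b by (simp_all add: B_def b_split mdeg_add mdeg_off_add top_def)
    define g where "g = shear a (\<lambda>i. - c i) (Poly_Mapping.single b' 1) * F"
    have shear_g: "shear a c g = Poly_Mapping.single b' 1 * shear a c F"
      by (simp add: g_def shear_mult shear_inverse)
    have "g \<in> X" using X F(2) by (simp add: g_def ideal.subspace_scale)
    moreover have "g \<in> forms t"
      unfolding g_def deg_b'[symmetric] by (intro forms_mult shear_forms forms_single F(1)) simp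
    moreover have "Poly_Mapping.lookup (shear a c g) b \<noteq> 0"
      using F_top by (simp add: shear_g b_split lookup_monomial_mult)
    moreover have "Poly_Mapping.lookup (shear a c g) y = 0"
      if y: "y \<noteq> b" "mdeg_off a y \<le> mdeg_off a b" for y
    proof (rule ccontr)
      assume "Poly_Mapping.lookup (shear a c g) y \<noteq> 0"
      then obtain e where e: "y = b' + e" "e \<in> Poly_Mapping.keys (shear a c F)"
        using keys_mult[of "Poly_Mapping.single b' 1" "shear a c F"]
        by (auto simp: shear_g in_keys_iff split: if_splits)
      have "mdeg_off a e = 0" using y(2) off_b' e(1) by (simp add: mdeg_off_add)
      moreover have "mdeg e = d + 1" using shear_forms[OF F(1)] e(2) by (auto simp: forms_iff)
      ultimately have "e = top" using mdeg_off_eq_0_iff[of a e] by (simp add: top_def)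
      thus False using y(1) e(1) b_split by simp
    qed
    ultimately show "\<exists>g\<in>X \<inter> forms t. Poly_Mapping.lookup (shear a c g) b \<noteq> 0 \<and>
        (\<forall>y\<in>B. y \<noteq> b \<longrightarrow> mdeg_off a y \<le> mdeg_off a b \<longrightarrow> Poly_Mapping.lookup (shear a c g) y = 0)"
      by blast
  qed (simp_all add: shear_add shear_mult shear_const lookup_add lookup_const_mult)
  moreover have "{p \<in> X \<inter> forms t. \<forall>b\<in>B. Poly_Mapping.lookup (shear a c p) b = 0} =
      X \<inter> ideal_pow (point_ideal P) m \<inter> forms t"
    unfolding B_def c_def Int_assoc ideal_pow_inter_forms[where P = P, OF a] by auto
  moreover have "card B = (m + (CARD('v) - 1) - 1) choose (CARD('v) - 1)"
    unfolding B_def using m t by (intro card_mdeg_off_less) auto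
  ultimately show ?thesis by (simp add: vdim_def Let_def)
qed

section \<open>Unexpected hypersurfaces\<close>

lemma adim_eq_vdim:
  fixes X :: "('v::finite, 'a::field) mpoly set"
  assumes "infinite (UNIV :: 'a set)" and "ideal.subspace X"
    and "in_hypersurface_of_degree X (d + 1)" and "m \<ge> 1" and "t \<ge> d + m"
  shows "int (adim X t m) = vdim X t m"
proof -
  obtain F where F: "F \<in> forms (d + 1)" "F \<noteq> 0" "F \<in> X"
    using assms(3) by (auto simp: in_hypersurface_of_degree_def)
  have dim: "int (mpoly.dim (X \<inter> ideal_pow (point_ideal P) m \<inter> forms t)) = vdim X t m"
    if "P \<noteq> (\<lambda>_. 0)" "eval F P \<noteq> 0" for P
    using dim_fat_point[OF assms(2) F(1,3) that(2,1) assms(4,5)] .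
  have "for_general_point (\<lambda>P. P \<noteq> (\<lambda>_. 0) \<and> eval F P \<noteq> 0)"
    by (rule for_general_point_off_hypersurface[OF assms(1) F(1) _ F(2)]) simp_all
  then obtain Q where Q: "Q \<noteq> (\<lambda>_. 0)" "eval F Q \<noteq> 0"
    unfolding for_general_point_def by blast
  let ?a = "mpoly.dim (X \<inter> ideal_pow (point_ideal Q) m \<inter> forms t)"
  have "for_general_point (\<lambda>P. mpoly.dim (X \<inter> ideal_pow (point_ideal P) m \<inter> forms t) = ?a)"
    by (rule for_general_point_off_hypersurface[OF assms(1) F(1) _ F(2)])
      (use dim Q in \<open>simp_all flip: of_nat_eq_iff[where 'a = int]\<close>)
  hence "adim X t m = ?a" by (rule adim_eqI[OF assms(1)])
  thus ?thesis using dim[OF Q] by simp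
qed

lemma adim_below_multiplicity:
  fixes X :: "('v::finite, 'a::field) mpoly set"
  assumes "infinite (UNIV :: 'a set)" and "t < m"
  shows "adim X t m = 0"
proof (rule adim_eqI[OF assms(1)])
  \<comment> \<open>The dimension is zero at every point, so any nonzero form defines a suitable open set.\<close>
  have "(var undefined :: ('v, 'a) mpoly) \<noteq> 0"
    by (metis var_def lookup_single_eq lookup_zero zero_neq_one)
  thus "for_general_point (\<lambda>P. mpoly.dim (X \<inter> ideal_pow (point_ideal P) m \<inter> forms t) = 0)"
    by (intro for_general_point_off_hypersurface[OF assms(1) forms_var])
      (use dim_below_multiplicity[OF _ assms(2)] in auto)
qed

theorem corollary3p5:
  fixes X :: "('v::finite, 'a::field) mpoly set"
  assumes "infinite (UNIV :: 'a set)"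
    and "reduced_subscheme X"
  shows "(\<forall>d. in_hypersurface_of_degree X (d + 1) \<longrightarrow>
            (\<forall>m\<ge>1. \<forall>t\<ge>d + m. int (adim X t m) = vdim X t m))
       \<and> (degenerate X \<longrightarrow>
            (\<forall>m\<ge>1. \<forall>t\<ge>m. \<not> unexpected_hypersurface X t m)
          \<and> (\<forall>m\<ge>1. \<forall>t. \<not> unexpected_hypersurface X t m))"
proof -
  have X: "ideal.subspace X"
    using assms(2) by (simp add: reduced_subscheme_def closed_subscheme_def homogeneous_ideal_def)
  have "\<not> unexpected_hypersurface X t m" if "degenerate X" "m \<ge> 1" for t m
  proof (cases "t < m")
    case True
    thus ?thesis
      using adim_below_multiplicity[OF assms(1) True, of X] by (simp add: unexpected_hypersurface_def edim_def)
  next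
    case False
    thus ?thesis
      using adim_eq_vdim[OF assms(1) X, of 0 m t] that
      by (simp add: degenerate_def unexpected_hypersurface_def edim_def)
  qed
  thus ?thesis using adim_eq_vdim[OF assms(1) X] by blast
qed

end
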